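(* Let $\mathcal C,\mathcal D,\mathcal E$ be categories, let $f,h,j:\mathcal C\to\mathcal D$ and $g,i,k:\mathcal D\to\mathcal E$ be functors, and let $\tau:f\to h$, $\sigma:h\to j$, $\alpha:g\to i$, $\beta:i\to k$ be natural transformations. Then $$(\beta\cdot\alpha)\circ(\sigma\cdot\tau)=(\beta\circ\sigma)\cdot(\alpha\circ\tau).$$
   Context: For natural transformations $\tau:f\to h$ and $\sigma:h\to j$ of functors $\mathcal C\to\mathcal D$, the (vertical) composition $\sigma\cdot\tau:f\to j$ is given by $(\sigma\cdot\tau)x:=\sigma x\circ\tau x$ for each object $x$. For $\tau:f\to h$ (functors $\mathcal C\to\mathcal D$) and $\alpha:g\to i$ (functors $\mathcal D\to\mathcal E$), the (horizontal) composition $\alpha\circ\tau:g\circ f\to i\circ h$ is given by $(\alpha\circ\tau)x:=\alpha(hx)\circ g(\tau x)$. *)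

theory Defs
  imports "HOL-Library.FuncSet"
begin

text \<open>
  Objects and morphisms of a category are carrier sets inside types, in the style of HOL-Algebra.
  The composite \<open>n \<odot>\<^bsub>C\<^esub> m\<close> means ``first \<open>m\<close>, then \<open>n\<close>'';
  only its values on composable morphisms matter.
\<close>

record ('o, 'm) category =
  Obj :: "'o set"
  Mor :: "'m set"
  src :: "'m \<Rightarrow> 'o"
  tgt :: "'m \<Rightarrow> 'o"
  ident :: "'o \<Rightarrow> 'm"
  mor_comp :: "'m \<Rightarrow> 'm \<Rightarrow> 'm" (infixl \<open>\<odot>\<index>\<close> 70)

definition Hom :: "('o, 'm) category \<Rightarrow> 'o \<Rightarrow> 'o \<Rightarrow> 'm set" where
  "Hom C x y = {m \<in> Mor C. src C m = x \<and> tgt C m = y}"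

locale category =
  fixes C :: "('o, 'm) category" (structure)
  assumes src_Obj: "m \<in> Mor C \<Longrightarrow> src C m \<in> Obj C"
    and tgt_Obj: "m \<in> Mor C \<Longrightarrow> tgt C m \<in> Obj C"
    and ident_Hom: "x \<in> Obj C \<Longrightarrow> ident C x \<in> Hom C x x"
    and compose_Hom: "\<lbrakk>m \<in> Hom C x y; n \<in> Hom C y z\<rbrakk> \<Longrightarrow> n \<odot> m \<in> Hom C x z"
    and ident_right: "m \<in> Hom C x y \<Longrightarrow> m \<odot> ident C x = m"
    and ident_left: "m \<in> Hom C x y \<Longrightarrow> ident C y \<odot> m = m"
    and compose_assoc:
      "\<lbrakk>m \<in> Hom C w x; n \<in> Hom C x y; p \<in> Hom C y z\<rbrakk> \<Longrightarrow> (p \<odot> n) \<odot> m = p \<odot> (n \<odot> m)"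

text \<open>
  A functor carries its source and target categories, and a natural transformation its source and
  target functors. The underlying maps are required to be \<^const>\<open>extensional\<close> on the
  carriers, so that HOL equality of these records is equality of functors, respectively of natural
  transformations.
\<close>

record ('o1, 'm1, 'o2, 'm2) cat_functor =
  fun_src :: "('o1, 'm1) category"
  fun_tgt :: "('o2, 'm2) category"
  obj_map :: "'o1 \<Rightarrow> 'o2"
  mor_map :: "'m1 \<Rightarrow> 'm2"

locale cat_functor = C: category C + D: category D
  for C :: "('o1, 'm1) category" and D :: "('o2, 'm2) category" +
  fixes f :: "('o1, 'm1, 'o2, 'm2) cat_functor"
  assumes fun_src: "fun_src f = C"
    and fun_tgt: "fun_tgt f = D"
    and obj_map_ext: "obj_map f \<in> extensional (Obj C)"
    and mor_map_ext: "mor_map f \<in> extensional (Mor C)"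
    and obj_map_Obj: "x \<in> Obj C \<Longrightarrow> obj_map f x \<in> Obj D"
    and mor_map_Hom: "m \<in> Hom C x y \<Longrightarrow> mor_map f m \<in> Hom D (obj_map f x) (obj_map f y)"
    and mor_map_ident: "x \<in> Obj C \<Longrightarrow> mor_map f (ident C x) = ident D (obj_map f x)"
    and mor_map_compose: "\<lbrakk>m \<in> Hom C x y; n \<in> Hom C y z\<rbrakk> \<Longrightarrow>
      mor_map f (n \<odot>\<^bsub>C\<^esub> m) = mor_map f n \<odot>\<^bsub>D\<^esub> mor_map f m"

definition fun_comp ::
  "('o2, 'm2, 'o3, 'm3) cat_functor \<Rightarrow> ('o1, 'm1, 'o2, 'm2) cat_functor
    \<Rightarrow> ('o1, 'm1, 'o3, 'm3) cat_functor" (infixr \<open>\<circ>\<^sub>F\<close> 75) where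
  "g \<circ>\<^sub>F f =
    \<lparr>fun_src = fun_src f,
     fun_tgt = fun_tgt g,
     obj_map = (\<lambda>x\<in>Obj (fun_src f). obj_map g (obj_map f x)),
     mor_map = (\<lambda>m\<in>Mor (fun_src f). mor_map g (mor_map f m))\<rparr>"

record ('o1, 'm1, 'o2, 'm2) nat_trans =
  nt_src :: "('o1, 'm1, 'o2, 'm2) cat_functor"
  nt_tgt :: "('o1, 'm1, 'o2, 'm2) cat_functor"
  nt_at :: "'o1 \<Rightarrow> 'm2"

locale nat_trans = f: cat_functor C D f + h: cat_functor C D h
  for C :: "('o1, 'm1) category" and D :: "('o2, 'm2) category" and f h +
  fixes \<tau> :: "('o1, 'm1, 'o2, 'm2) nat_trans"
  assumes nt_src: "nt_src \<tau> = f"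
    and nt_tgt: "nt_tgt \<tau> = h"
    and nt_at_ext: "nt_at \<tau> \<in> extensional (Obj C)"
    and nt_at_Hom: "x \<in> Obj C \<Longrightarrow> nt_at \<tau> x \<in> Hom D (obj_map f x) (obj_map h x)"
    and naturality: "m \<in> Hom C x y \<Longrightarrow>
      nt_at \<tau> y \<odot>\<^bsub>D\<^esub> mor_map f m = mor_map h m \<odot>\<^bsub>D\<^esub> nt_at \<tau> x"

text \<open>
  Both compositions are total functions on records; they are meaningful when
  \<open>nt_tgt \<tau> = nt_src \<sigma>\<close> in the vertical case, and when the target category of the
  functors of \<open>\<tau>\<close> is the source category of those of \<open>\<alpha>\<close> in the horizontal case.
\<close>

definition vert_comp ::
  "('o1, 'm1, 'o2, 'm2) nat_trans \<Rightarrow> ('o1, 'm1, 'o2, 'm2) nat_trans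
    \<Rightarrow> ('o1, 'm1, 'o2, 'm2) nat_trans" (infixr \<open>\<cdot>\<^sub>V\<close> 75) where
  "\<sigma> \<cdot>\<^sub>V \<tau> =
    \<lparr>nt_src = nt_src \<tau>,
     nt_tgt = nt_tgt \<sigma>,
     nt_at = (\<lambda>x\<in>Obj (fun_src (nt_src \<tau>)).
       nt_at \<sigma> x \<odot>\<^bsub>fun_tgt (nt_src \<tau>)\<^esub> nt_at \<tau> x)\<rparr>"

definition horiz_comp ::
  "('o2, 'm2, 'o3, 'm3) nat_trans \<Rightarrow> ('o1, 'm1, 'o2, 'm2) nat_trans
    \<Rightarrow> ('o1, 'm1, 'o3, 'm3) nat_trans" (infixr \<open>\<circ>\<^sub>H\<close> 75) where
  "\<alpha> \<circ>\<^sub>H \<tau> =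
    \<lparr>nt_src = nt_src \<alpha> \<circ>\<^sub>F nt_src \<tau>,
     nt_tgt = nt_tgt \<alpha> \<circ>\<^sub>F nt_tgt \<tau>,
     nt_at = (\<lambda>x\<in>Obj (fun_src (nt_src \<tau>)).
       nt_at \<alpha> (obj_map (nt_tgt \<tau>) x)
         \<odot>\<^bsub>fun_tgt (nt_src \<alpha>)\<^esub> mor_map (nt_src \<alpha>) (nt_at \<tau> x))\<rparr>"

lemma Hom_Mor: "m \<in> Hom C x y \<Longrightarrow> m \<in> Mor C"
  by (simp add: Hom_def)

lemma (in category) Hom_Obj: "m \<in> Hom C x y \<Longrightarrow> x \<in> Obj C \<and> y \<in> Obj C"
  using src_Obj tgt_Obj by (auto simp: Hom_def)

lemma cat_functor_fun_comp:
  assumes "cat_functor C D f" and "cat_functor D E g"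
  shows "cat_functor C E (g \<circ>\<^sub>F f)"
proof -
  interpret f: cat_functor C D f by fact
  interpret g: cat_functor D E g by fact
  show ?thesis
  proof
    fix m x y assume m: "m \<in> Hom C x y"
    show "mor_map (g \<circ>\<^sub>F f) m \<in> Hom E (obj_map (g \<circ>\<^sub>F f) x) (obj_map (g \<circ>\<^sub>F f) y)"
      using g.mor_map_Hom[OF f.mor_map_Hom[OF m]] f.C.Hom_Obj[OF m] Hom_Mor[OF m]
      by (simp add: fun_comp_def f.fun_src)
  next
    fix m n x y z assume m: "m \<in> Hom C x y" and n: "n \<in> Hom C y z"
    show "mor_map (g \<circ>\<^sub>F f) (n \<odot>\<^bsub>C\<^esub> m) =
        mor_map (g \<circ>\<^sub>F f) n \<odot>\<^bsub>E\<^esub> mor_map (g \<circ>\<^sub>F f) m"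
      using Hom_Mor[OF m] Hom_Mor[OF n] Hom_Mor[OF f.C.compose_Hom[OF m n]]
        f.mor_map_compose[OF m n] g.mor_map_compose[OF f.mor_map_Hom[OF m] f.mor_map_Hom[OF n]]
      by (simp add: fun_comp_def f.fun_src)
  next
    fix x assume x: "x \<in> Obj C"
    show "mor_map (g \<circ>\<^sub>F f) (ident C x) = ident E (obj_map (g \<circ>\<^sub>F f) x)"
      using x Hom_Mor[OF f.C.ident_Hom[OF x]] f.mor_map_ident[OF x]
        g.mor_map_ident[OF f.obj_map_Obj[OF x]]
      by (simp add: fun_comp_def f.fun_src)
  qed (auto simp: fun_comp_def f.fun_src g.fun_tgt f.obj_map_Obj g.obj_map_Obj)
qed

lemma nat_trans_vert_comp:
  assumes "nat_trans C D f h \<tau>" and "nat_trans C D h j \<sigma>"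
  shows "nat_trans C D f j (\<sigma> \<cdot>\<^sub>V \<tau>)"
proof -
  interpret t: nat_trans C D f h \<tau> by fact
  interpret s: nat_trans C D h j \<sigma> by fact
  note defs = vert_comp_def t.nt_src s.nt_tgt t.f.fun_src t.f.fun_tgt
  show ?thesis
  proof
    fix x assume x: "x \<in> Obj C"
    show "nt_at (\<sigma> \<cdot>\<^sub>V \<tau>) x \<in> Hom D (obj_map f x) (obj_map j x)"
      using x t.f.D.compose_Hom[OF t.nt_at_Hom[OF x] s.nt_at_Hom[OF x]] by (simp add: defs)
  next
    fix m x y assume m: "m \<in> Hom C x y"
    then have x: "x \<in> Obj C" and y: "y \<in> Obj C" using t.f.C.Hom_Obj by auto
    have "(nt_at \<sigma> y \<odot>\<^bsub>D\<^esub> nt_at \<tau> y) \<odot>\<^bsub>D\<^esub> mor_map f m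
        = nt_at \<sigma> y \<odot>\<^bsub>D\<^esub> (mor_map h m \<odot>\<^bsub>D\<^esub> nt_at \<tau> x)"
      using t.f.D.compose_assoc[OF t.f.mor_map_Hom[OF m] t.nt_at_Hom[OF y] s.nt_at_Hom[OF y]]
        t.naturality[OF m] by simp
    also have "\<dots> = (mor_map j m \<odot>\<^bsub>D\<^esub> nt_at \<sigma> x) \<odot>\<^bsub>D\<^esub> nt_at \<tau> x"
      using t.f.D.compose_assoc[OF t.nt_at_Hom[OF x] t.h.mor_map_Hom[OF m] s.nt_at_Hom[OF y]]
        s.naturality[OF m] by simp
    also have "\<dots> = mor_map j m \<odot>\<^bsub>D\<^esub> (nt_at \<sigma> x \<odot>\<^bsub>D\<^esub> nt_at \<tau> x)"
      by (rule t.f.D.compose_assoc[OF t.nt_at_Hom[OF x] s.nt_at_Hom[OF x] s.h.mor_map_Hom[OF m]])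
    finally show "nt_at (\<sigma> \<cdot>\<^sub>V \<tau>) y \<odot>\<^bsub>D\<^esub> mor_map f m
        = mor_map j m \<odot>\<^bsub>D\<^esub> nt_at (\<sigma> \<cdot>\<^sub>V \<tau>) x"
      using x y by (simp add: defs)
  qed (auto simp: defs)
qed

lemma nat_trans_horiz_comp:
  assumes "nat_trans C D f h \<tau>" and "nat_trans D E g i \<alpha>"
  shows "nat_trans C E (g \<circ>\<^sub>F f) (i \<circ>\<^sub>F h) (\<alpha> \<circ>\<^sub>H \<tau>)"
proof -
  interpret t: nat_trans C D f h \<tau> by fact
  interpret a: nat_trans D E g i \<alpha> by fact
  interpret gf: cat_functor C E "g \<circ>\<^sub>F f"
    using t.f.cat_functor_axioms a.f.cat_functor_axioms by (rule cat_functor_fun_comp)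
  interpret ih: cat_functor C E "i \<circ>\<^sub>F h"
    using t.h.cat_functor_axioms a.h.cat_functor_axioms by (rule cat_functor_fun_comp)
  note defs = horiz_comp_def fun_comp_def t.nt_src t.nt_tgt a.nt_src a.nt_tgt
    t.f.fun_src t.h.fun_src a.f.fun_tgt
  show ?thesis
  proof
    fix x assume x: "x \<in> Obj C"
    show "nt_at (\<alpha> \<circ>\<^sub>H \<tau>) x \<in> Hom E (obj_map (g \<circ>\<^sub>F f) x) (obj_map (i \<circ>\<^sub>F h) x)"
      using x a.f.D.compose_Hom[OF a.f.mor_map_Hom[OF t.nt_at_Hom[OF x]]
          a.nt_at_Hom[OF t.h.obj_map_Obj[OF x]]] by (simp add: defs)
  next
    fix m x y assume m: "m \<in> Hom C x y"
    then have x: "x \<in> Obj C" and y: "y \<in> Obj C" using t.f.C.Hom_Obj by auto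
    note gt = a.f.mor_map_Hom[OF t.nt_at_Hom]
    note ah = a.nt_at_Hom[OF t.h.obj_map_Obj]
    note gm = a.f.mor_map_Hom[OF t.f.mor_map_Hom[OF m]]
    note ghm = a.f.mor_map_Hom[OF t.h.mor_map_Hom[OF m]]
    note ihm = a.h.mor_map_Hom[OF t.h.mor_map_Hom[OF m]]
    have "(nt_at \<alpha> (obj_map h y) \<odot>\<^bsub>E\<^esub> mor_map g (nt_at \<tau> y)) \<odot>\<^bsub>E\<^esub> mor_map g (mor_map f m)
        = nt_at \<alpha> (obj_map h y) \<odot>\<^bsub>E\<^esub> mor_map g (nt_at \<tau> y \<odot>\<^bsub>D\<^esub> mor_map f m)"
      using a.f.D.compose_assoc[OF gm gt[OF y] ah[OF y]]
        a.f.mor_map_compose[OF t.f.mor_map_Hom[OF m] t.nt_at_Hom[OF y]] by simp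
    also have "\<dots> = nt_at \<alpha> (obj_map h y) \<odot>\<^bsub>E\<^esub> (mor_map g (mor_map h m) \<odot>\<^bsub>E\<^esub> mor_map g (nt_at \<tau> x))"
      using t.naturality[OF m]
        a.f.mor_map_compose[OF t.nt_at_Hom[OF x] t.h.mor_map_Hom[OF m]] by simp
    also have "\<dots> = (mor_map i (mor_map h m) \<odot>\<^bsub>E\<^esub> nt_at \<alpha> (obj_map h x)) \<odot>\<^bsub>E\<^esub> mor_map g (nt_at \<tau> x)"
      using a.f.D.compose_assoc[OF gt[OF x] ghm ah[OF y]]
        a.naturality[OF t.h.mor_map_Hom[OF m]] by simp
    also have "\<dots> = mor_map i (mor_map h m) \<odot>\<^bsub>E\<^esub> (nt_at \<alpha> (obj_map h x) \<odot>\<^bsub>E\<^esub> mor_map g (nt_at \<tau> x))"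
      by (rule a.f.D.compose_assoc[OF gt[OF x] ah[OF x] ihm])
    finally show "nt_at (\<alpha> \<circ>\<^sub>H \<tau>) y \<odot>\<^bsub>E\<^esub> mor_map (g \<circ>\<^sub>F f) m
        = mor_map (i \<circ>\<^sub>F h) m \<odot>\<^bsub>E\<^esub> nt_at (\<alpha> \<circ>\<^sub>H \<tau>) x"
      using x y Hom_Mor[OF m] by (simp add: defs)
  qed (auto simp: defs)
qed

end

theory Submission
  imports Defs
begin

text \<open>
  Both sides have the functors \<open>g \<circ>\<^sub>F f\<close> and \<open>k \<circ>\<^sub>F j\<close> as source and target, so only their
  components matter. At an object \<open>x\<close>, write \<open>\<alpha>jx\<close> for the component of \<open>\<alpha>\<close> at \<open>j x\<close>. Since \<open>g\<close>
  preserves composition, the left-hand component is \<open>\<beta>jx \<alpha>jx g(\<sigma>x) g(\<tau>x)\<close>, while the right-hand one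
  is \<open>\<beta>jx i(\<sigma>x) \<alpha>hx g(\<tau>x)\<close>. The two middle factors agree by naturality of \<open>\<alpha>\<close> at the morphism
  \<open>\<sigma>x : h x \<rightarrow> j x\<close>; the outer data \<open>\<beta>\<close> and \<open>\<tau>\<close> enter only through associativity.
\<close>

text \<open>
  Exchanging the middle of a fourfold composite, in the form of a commuting square
  \<open>a s = s' a'\<close> flanked by \<open>t\<close> and \<open>b\<close>: all the rebracketing in the interchange law is this.
\<close>

lemma (in category) compose_middle_square:
  assumes t: "t \<in> Hom C u v" and s: "s \<in> Hom C v w" and a: "a \<in> Hom C w y"
    and a': "a' \<in> Hom C v x" and s': "s' \<in> Hom C x y" and b: "b \<in> Hom C y z"
    and square: "a \<odot> s = s' \<odot> a'"
  shows "(b \<odot> a) \<odot> (s \<odot> t) = (b \<odot> s') \<odot> (a' \<odot> t)"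
proof -
  have "(b \<odot> a) \<odot> (s \<odot> t) = b \<odot> ((a \<odot> s) \<odot> t)"
    using compose_assoc[OF compose_Hom[OF t s] a b] compose_assoc[OF t s a] by simp
  also have "\<dots> = b \<odot> (s' \<odot> (a' \<odot> t))"
    using square compose_assoc[OF t a' s'] by simp
  also have "\<dots> = (b \<odot> s') \<odot> (a' \<odot> t)"
    using compose_assoc[OF compose_Hom[OF t a'] s' b] by simp
  finally show ?thesis .
qed

theorem mainTheorem6:
  fixes C :: "('o1, 'm1) category"
    and D :: "('o2, 'm2) category"
    and E :: "('o3, 'm3) category"
    and f h j :: "('o1, 'm1, 'o2, 'm2) cat_functor"
    and g i k :: "('o2, 'm2, 'o3, 'm3) cat_functor"
    and \<tau> \<sigma> :: "('o1, 'm1, 'o2, 'm2) nat_trans"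
    and \<alpha> \<beta> :: "('o2, 'm2, 'o3, 'm3) nat_trans"
  assumes "category C" and "category D" and "category E"
    and "cat_functor C D f" and "cat_functor C D h" and "cat_functor C D j"
    and "cat_functor D E g" and "cat_functor D E i" and "cat_functor D E k"
    and "nat_trans C D f h \<tau>" and "nat_trans C D h j \<sigma>"
    and "nat_trans D E g i \<alpha>" and "nat_trans D E i k \<beta>"
  shows "(\<beta> \<cdot>\<^sub>V \<alpha>) \<circ>\<^sub>H (\<sigma> \<cdot>\<^sub>V \<tau>) = (\<beta> \<circ>\<^sub>H \<sigma>) \<cdot>\<^sub>V (\<alpha> \<circ>\<^sub>H \<tau>)"
proof -
  interpret \<tau>: nat_trans C D f h \<tau> by fact
  interpret \<sigma>: nat_trans C D h j \<sigma> by fact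
  interpret \<alpha>: nat_trans D E g i \<alpha> by fact
  interpret \<beta>: nat_trans D E i k \<beta> by fact
  note data = \<tau>.nt_src \<tau>.nt_tgt \<sigma>.nt_src \<sigma>.nt_tgt \<alpha>.nt_src \<alpha>.nt_tgt \<beta>.nt_src \<beta>.nt_tgt
    \<tau>.f.fun_src \<tau>.f.fun_tgt \<tau>.h.fun_src \<alpha>.f.fun_src \<alpha>.f.fun_tgt \<alpha>.h.fun_tgt
  have component:
    "(nt_at \<beta> (obj_map j x) \<odot>\<^bsub>E\<^esub> nt_at \<alpha> (obj_map j x))
        \<odot>\<^bsub>E\<^esub> mor_map g (nt_at \<sigma> x \<odot>\<^bsub>D\<^esub> nt_at \<tau> x)
      = (nt_at \<beta> (obj_map j x) \<odot>\<^bsub>E\<^esub> mor_map i (nt_at \<sigma> x))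
        \<odot>\<^bsub>E\<^esub> (nt_at \<alpha> (obj_map h x) \<odot>\<^bsub>E\<^esub> mor_map g (nt_at \<tau> x))"
    if x: "x \<in> Obj C" for x
  proof -
    note \<tau>x = \<tau>.nt_at_Hom[OF x] and \<sigma>x = \<sigma>.nt_at_Hom[OF x]
    note hx = \<tau>.h.obj_map_Obj[OF x] and jx = \<sigma>.h.obj_map_Obj[OF x]
    show ?thesis
      unfolding \<alpha>.f.mor_map_compose[OF \<tau>x \<sigma>x]
      by (rule \<alpha>.f.D.compose_middle_square[OF \<alpha>.f.mor_map_Hom[OF \<tau>x] \<alpha>.f.mor_map_Hom[OF \<sigma>x]
            \<alpha>.nt_at_Hom[OF jx] \<alpha>.nt_at_Hom[OF hx] \<alpha>.h.mor_map_Hom[OF \<sigma>x]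
            \<beta>.nt_at_Hom[OF jx] \<alpha>.naturality[OF \<sigma>x]])
  qed
  show ?thesis
    using component \<sigma>.h.obj_map_Obj
    by (auto simp: vert_comp_def horiz_comp_def fun_comp_def data intro!: restrict_ext)
qed

end
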